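(* Let $\mathcal{P}$ be a class of languages, let $\mathcal{C}$ be a $\mathcal{P}$-lingual Gröbner category (in particular, $\mathcal{C}$ is directed and equipped with a norm $\nu$), let $\mathbf{k}$ be a field, and let $M$ be a finitely generated representation of $\mathcal{C}$ over $\mathbf{k}$. Then the Hilbert series $\mathrm{H}_M$ is a $\mathbf{Z}$-linear combination of (finitely many) series of the form $\mathrm{H}_{\mathcal{L}}$, where each $\mathcal{L}$ is a language of class $\mathcal{P}$.
   Context: $\mathcal{C}$ is essentially small and directed: every morphism $x\to x$ is the identity. $|\mathcal{C}|$ is the set of isomorphism classes of objects. A norm on $\mathcal{C}$ is a function $\nu\colon|\mathcal{C}|\to\mathbf{N}$. A representation of $\mathcal{C}$ over $\mathbf{k}$ is a functor from $\mathcal{C}$ to $\mathbf{k}$-vector spaces; it is finitely generated if it is the smallest subrepresentation containing some finite set of elements of the spaces $M(x)$. Its Hilbert series is $\mathrm{H}_M(t)=\sum_{x\in|\mathcal{C}|}\dim_{\mathbf{k}}M(x)\,t^{\nu(x)}$. For an object $x$, $|\mathcal{C}_x|$ is the set of isomorphism classes of morphisms $x\to y$ ($y$ varying) in the category of morphisms out of $x$, partially ordered by $f\le g$ iff $g=hf$ for some $h$. The (directed) category $\mathcal{C}$ is Gröbner if for every object $x$: (G1) the set $|\mathcal{C}_x|$ admits an admissible order, i.e. a well-order $\preceq$ such that for $f,f'\in\mathrm{Hom}(x,y)$ with $f\prec f'$ and $g\in\mathrm{Hom}(y,z)$ one has $gf\prec gf'$; and (G2) the poset $(|\mathcal{C}_x|,\le)$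 is noetherian, i.e. every infinite sequence $x_1,x_2,\dots$ in it has $i<j$ with $x_i\le x_j$. For a finite set (alphabet) $\Sigma$, $\Sigma^\star$ is the set of finite words in $\Sigma$, $\ell(w)$ is the length of $w$, and a language on $\Sigma$ is a subset $\mathcal{L}\subseteq\Sigma^\star$. Its Hilbert series is $\mathrm{H}_{\mathcal{L}}(t)=\sum_{w\in\mathcal{L}}t^{\ell(w)}$. An ideal of a poset $X$ is a subset $I$ such that $x\in I$, $x\le y$ imply $y\in I$. A $\mathcal{P}$-lingual structure on $\mathcal{C}$ at $x$ consists of a finite alphabet $\Sigma$ and an injection $i\colon|\mathcal{C}_x|\to\Sigma^\star$ such that (1) for every $f\colon x\to y$ in $|\mathcal{C}_x|$, $\nu(y)=\ell(i(f))$; and (2) for every poset ideal $J$ of $|\mathcal{C}_x|$ the language $i(J)$ is of class $\mathcal{P}$. $\mathcal{C}$ is $\mathcal{P}$-lingual if it admits a $\mathcal{P}$-lingual structure at every object. *)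

theory Defs
  imports
    "HOL-Computational_Algebra.Formal_Power_Series"
    "Jordan_Normal_Form.Missing_VectorSpace"
begin

section \<open>Categories\<close>

text \<open>Objects and morphisms form sets, so every category below is small. Objects may be isomorphic
  without being equal.\<close>

record ('o, 'm) cat =
  Obj :: "'o set"
  Mor :: "'m set"
  Dom :: "'m \<Rightarrow> 'o"
  Cod :: "'m \<Rightarrow> 'o"
  Ident :: "'o \<Rightarrow> 'm"
  Comp :: "'m \<Rightarrow> 'm \<Rightarrow> 'm"  (infixr "\<cdot>\<index>" 70)

definition Hom :: "('o, 'm) cat \<Rightarrow> 'o \<Rightarrow> 'o \<Rightarrow> 'm set" where
  "Hom C x y = {f \<in> Mor C. Dom C f = x \<and> Cod C f = y}"

locale category =
  fixes C :: "('o, 'm) cat" (structure)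
  assumes dom_obj: "f \<in> Mor C \<Longrightarrow> Dom C f \<in> Obj C"
    and cod_obj: "f \<in> Mor C \<Longrightarrow> Cod C f \<in> Obj C"
    and ident_hom: "x \<in> Obj C \<Longrightarrow> Ident C x \<in> Hom C x x"
    and comp_hom: "f \<in> Hom C x y \<Longrightarrow> g \<in> Hom C y z \<Longrightarrow> g \<cdot> f \<in> Hom C x z"
    and comp_ident: "f \<in> Hom C x y \<Longrightarrow> f \<cdot> Ident C x = f"
    and ident_comp: "f \<in> Hom C x y \<Longrightarrow> Ident C y \<cdot> f = f"
    and comp_assoc: "f \<in> Hom C w x \<Longrightarrow> g \<in> Hom C x y \<Longrightarrow> h \<in> Hom C y z
      \<Longrightarrow> (h \<cdot> g) \<cdot> f = h \<cdot> (g \<cdot> f)"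

definition directed_category :: "('o, 'm) cat \<Rightarrow> bool" where
  "directed_category C \<longleftrightarrow> category C \<and> (\<forall>x\<in>Obj C. \<forall>f\<in>Hom C x x. f = Ident C x)"

definition iso_rel :: "('o, 'm) cat \<Rightarrow> ('o \<times> 'o) set" where
  "iso_rel C = {(x, y). x \<in> Obj C \<and> y \<in> Obj C \<and>
     (\<exists>f\<in>Hom C x y. \<exists>g\<in>Hom C y x. g \<cdot>\<^bsub>C\<^esub> f = Ident C x \<and> f \<cdot>\<^bsub>C\<^esub> g = Ident C y)}"

definition iso_class :: "('o, 'm) cat \<Rightarrow> 'o \<Rightarrow> 'o set" where
  "iso_class C x = iso_rel C `` {x}"

definition iso_classes :: "('o, 'm) cat \<Rightarrow> 'o set set" where
  "iso_classes C = Obj C // iso_rel C"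

lemma (in category) equiv_iso_rel: "equiv (Obj C) (iso_rel C)"
proof (rule equivI)
  show "iso_rel C \<subseteq> Obj C \<times> Obj C" by (auto simp: iso_rel_def)
  show "refl_on (Obj C) (iso_rel C)"
  proof (rule refl_onI)
    fix x assume "x \<in> Obj C"
    then show "(x, x) \<in> iso_rel C"
      unfolding iso_rel_def using ident_hom[of x] comp_ident[of "Ident C x" x x] by blast
  qed
  show "sym (iso_rel C)" unfolding iso_rel_def sym_def by blast
  show "trans (iso_rel C)"
  proof (rule transI)
    fix x y z assume "(x, y) \<in> iso_rel C" "(y, z) \<in> iso_rel C"
    then obtain f g f' g' where xz: "x \<in> Obj C" "z \<in> Obj C"
      and h: "f \<in> Hom C x y" "g \<in> Hom C y x" "f' \<in> Hom C y z" "g' \<in> Hom C z y"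
      and e: "g \<cdot> f = Ident C x" "f \<cdot> g = Ident C y" "g' \<cdot> f' = Ident C y" "f' \<cdot> g' = Ident C z"
      unfolding iso_rel_def by blast
    have "(g \<cdot> g') \<cdot> (f' \<cdot> f) = g \<cdot> ((g' \<cdot> f') \<cdot> f)"
      by (simp only: comp_assoc[OF comp_hom[OF h(1,3)] h(4,2)] comp_assoc[OF h(1,3,4)])
    then have 1: "(g \<cdot> g') \<cdot> (f' \<cdot> f) = Ident C x" by (simp only: e ident_comp[OF h(1)])
    have "(f' \<cdot> f) \<cdot> (g \<cdot> g') = f' \<cdot> ((f \<cdot> g) \<cdot> g')"
      by (simp only: comp_assoc[OF comp_hom[OF h(4,2)] h(1,3)] comp_assoc[OF h(4,2,1)])
    then have 2: "(f' \<cdot> f) \<cdot> (g \<cdot> g') = Ident C z" by (simp only: e ident_comp[OF h(4)])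
    show "(x, z) \<in> iso_rel C"
      using xz 1 2 comp_hom[OF h(1,3)] comp_hom[OF h(4,2)] unfolding iso_rel_def by blast
  qed
qed

text \<open>The category of morphisms out of \<open>x\<close>: a morphism from \<open>f\<close> to \<open>g\<close> is a morphism \<open>h\<close> with
  \<open>g = h \<cdot> f\<close>, recorded as the triple \<open>(f, h, g)\<close>.\<close>

definition coslice :: "('o, 'm) cat \<Rightarrow> 'o \<Rightarrow> ('m, 'm \<times> 'm \<times> 'm) cat" where
  "coslice C x = \<lparr>
     Obj = {f \<in> Mor C. Dom C f = x},
     Mor = {(f, h, g). f \<in> Mor C \<and> Dom C f = x \<and> g \<in> Mor C \<and> Dom C g = x \<and>
             h \<in> Hom C (Cod C f) (Cod C g) \<and> g = h \<cdot>\<^bsub>C\<^esub> f},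
     Dom = (\<lambda>(f, h, g). f),
     Cod = (\<lambda>(f, h, g). g),
     Ident = (\<lambda>f. (f, Ident C (Cod C f), f)),
     Comp = (\<lambda>(_, k, l) (f, h, _). (f, k \<cdot>\<^bsub>C\<^esub> h, l)) \<rparr>"

lemma coslice_hom_iff:
  "(e, h, g') \<in> Hom (coslice C x) f g \<longleftrightarrow> e = f \<and> g' = g \<and>
     f \<in> Mor C \<and> Dom C f = x \<and> g \<in> Mor C \<and> Dom C g = x \<and>
     h \<in> Hom C (Cod C f) (Cod C g) \<and> g = h \<cdot>\<^bsub>C\<^esub> f"
  by (auto simp: coslice_def Hom_def)

lemma coslice_comp: "(g, k, l) \<cdot>\<^bsub>coslice C x\<^esub> (f, h, e) = (f, k \<cdot>\<^bsub>C\<^esub> h, l)"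
  by (simp add: coslice_def)

lemma coslice_ident: "Ident (coslice C x) f = (f, Ident C (Cod C f), f)"
  by (simp add: coslice_def)

lemma (in category) category_coslice: "category (coslice C x)"
proof
  fix f :: 'm
  assume "f \<in> Obj (coslice C x)"
  then have f: "f \<in> Mor C" "Dom C f = x" by (simp_all add: coslice_def)
  then have "f \<in> Hom C x (Cod C f)" by (simp add: Hom_def)
  then show "Ident (coslice C x) f \<in> Hom (coslice C x) f f"
    using f by (simp add: coslice_ident coslice_hom_iff ident_hom cod_obj ident_comp)
next
  fix p q and f g h :: 'm
  assume a: "p \<in> Hom (coslice C x) f g" "q \<in> Hom (coslice C x) g h"
  obtain e1 k g1 where p: "p = (e1, k, g1)" by (cases p)
  obtain g2 l h1 where q: "q = (g2, l, h1)" by (cases q)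
  note a' = a[unfolded p q coslice_hom_iff]
  have f: "f \<in> Hom C x (Cod C f)" using a' by (simp add: Hom_def)
  have k: "k \<in> Hom C (Cod C f) (Cod C g)" and l: "l \<in> Hom C (Cod C g) (Cod C h)"
    using a' by blast+
  have "h = (l \<cdot> k) \<cdot> f"
    using comp_assoc[OF f k l] a' by metis
  then show "q \<cdot>\<^bsub>coslice C x\<^esub> p \<in> Hom (coslice C x) f h"
    using a' comp_hom[OF k l] unfolding p q coslice_comp coslice_hom_iff by blast
next
  fix p and f g :: 'm
  assume a: "p \<in> Hom (coslice C x) f g"
  obtain e1 k g1 where p: "p = (e1, k, g1)" by (cases p)
  note a' = a[unfolded p coslice_hom_iff]
  have k: "k \<in> Hom C (Cod C f) (Cod C g)" using a' by blast
  show "p \<cdot>\<^bsub>coslice C x\<^esub> Ident (coslice C x) f = p"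
    using a' unfolding p coslice_comp coslice_ident comp_ident[OF k] by blast
  show "Ident (coslice C x) g \<cdot>\<^bsub>coslice C x\<^esub> p = p"
    using a' unfolding p coslice_comp coslice_ident ident_comp[OF k] by blast
next
  fix p q r and e f g h :: 'm
  assume a: "p \<in> Hom (coslice C x) e f" "q \<in> Hom (coslice C x) f g" "r \<in> Hom (coslice C x) g h"
  obtain e1 k f1 where p: "p = (e1, k, f1)" by (cases p)
  obtain f2 l g1 where q: "q = (f2, l, g1)" by (cases q)
  obtain g2 m h1 where r: "r = (g2, m, h1)" by (cases r)
  have "(m \<cdot> l) \<cdot> k = m \<cdot> (l \<cdot> k)"
    by (rule comp_assoc) (use a[unfolded p q r coslice_hom_iff] in blast)+
  then show "(r \<cdot>\<^bsub>coslice C x\<^esub> q) \<cdot>\<^bsub>coslice C x\<^esub> p = r \<cdot>\<^bsub>coslice C x\<^esub> (q \<cdot>\<^bsub>coslice C x\<^esub> p)"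
    by (simp add: p q r coslice_comp)
qed (auto simp: coslice_def)

abbreviation mor_classes :: "('o, 'm) cat \<Rightarrow> 'o \<Rightarrow> 'm set set" where
  "mor_classes C x \<equiv> iso_classes (coslice C x)"

abbreviation mor_class :: "('o, 'm) cat \<Rightarrow> 'o \<Rightarrow> 'm \<Rightarrow> 'm set" where
  "mor_class C x f \<equiv> iso_class (coslice C x) f"

definition mor_le :: "('o, 'm) cat \<Rightarrow> 'm set \<Rightarrow> 'm set \<Rightarrow> bool" where
  "mor_le C A B \<longleftrightarrow> (\<exists>f\<in>A. \<exists>g\<in>B. \<exists>h\<in>Hom C (Cod C f) (Cod C g). g = h \<cdot>\<^bsub>C\<^esub> f)"

section \<open>Groebner categories\<close>

definition admissible_order :: "('o, 'm) cat \<Rightarrow> 'o \<Rightarrow> ('m set \<times> 'm set) set \<Rightarrow> bool" where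
  "admissible_order C x r \<longleftrightarrow> well_order_on (mor_classes C x) r \<and>
     (\<forall>y z. \<forall>f\<in>Hom C x y. \<forall>f'\<in>Hom C x y. \<forall>g\<in>Hom C y z.
        (mor_class C x f, mor_class C x f') \<in> r - Id \<longrightarrow>
        (mor_class C x (g \<cdot>\<^bsub>C\<^esub> f), mor_class C x (g \<cdot>\<^bsub>C\<^esub> f')) \<in> r - Id)"

definition noetherian_poset :: "'p set \<Rightarrow> ('p \<Rightarrow> 'p \<Rightarrow> bool) \<Rightarrow> bool" where
  "noetherian_poset X leq \<longleftrightarrow>
     (\<forall>s :: nat \<Rightarrow> 'p. (\<forall>i. s i \<in> X) \<longrightarrow> (\<exists>i j. i < j \<and> leq (s i) (s j)))"

definition groebner_category :: "('o, 'm) cat \<Rightarrow> bool" where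
  "groebner_category C \<longleftrightarrow> directed_category C \<and>
     (\<forall>x\<in>Obj C. (\<exists>r. admissible_order C x r) \<and>
                noetherian_poset (mor_classes C x) (mor_le C))"

section \<open>Languages and lingual structures\<close>

text \<open>A language is given together with its alphabet, as a pair \<open>(\<Sigma>, L)\<close>; different members of a
  class of languages may have different alphabets.\<close>

type_synonym 'a lang = "'a set \<times> 'a list set"

definition language_class :: "'a lang set \<Rightarrow> bool" where
  "language_class P \<longleftrightarrow> (\<forall>(\<Sigma>, L)\<in>P. finite \<Sigma> \<and> L \<subseteq> lists \<Sigma>)"

definition lang_series :: "'a list set \<Rightarrow> int fps" where
  "lang_series L = Abs_fps (\<lambda>n. int (card {w \<in> L. length w = n}))"

definition poset_ideal :: "'p set \<Rightarrow> ('p \<Rightarrow> 'p \<Rightarrow> bool) \<Rightarrow> 'p set \<Rightarrow> bool" where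
  "poset_ideal X leq I \<longleftrightarrow> I \<subseteq> X \<and> (\<forall>x\<in>I. \<forall>y\<in>X. leq x y \<longrightarrow> y \<in> I)"

text \<open>A norm is an arbitrary function \<open>\<nu>\<close> from isomorphism classes of objects to natural numbers;
  its values outside \<open>iso_classes C\<close> are irrelevant.\<close>

definition lingual_structure ::
  "'a lang set \<Rightarrow> ('o, 'm) cat \<Rightarrow> ('o set \<Rightarrow> nat) \<Rightarrow> 'o \<Rightarrow> 'a set \<Rightarrow> ('m set \<Rightarrow> 'a list) \<Rightarrow> bool"
where
  "lingual_structure P C \<nu> x \<Sigma> i \<longleftrightarrow>
     finite \<Sigma> \<and> i ` mor_classes C x \<subseteq> lists \<Sigma> \<and> inj_on i (mor_classes C x) \<and>
     (\<forall>y. \<forall>f\<in>Hom C x y. \<nu> (iso_class C y) = length (i (mor_class C x f))) \<and>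
     (\<forall>J. poset_ideal (mor_classes C x) (mor_le C) J \<longrightarrow> (\<Sigma>, i ` J) \<in> P)"

definition lingual_category ::
  "'a lang set \<Rightarrow> ('o, 'm) cat \<Rightarrow> ('o set \<Rightarrow> nat) \<Rightarrow> bool" where
  "lingual_category P C \<nu> \<longleftrightarrow> (\<forall>x\<in>Obj C. \<exists>\<Sigma> i. lingual_structure P C \<nu> x \<Sigma> i)"

section \<open>Representations\<close>

text \<open>The spaces of a representation are separate vector spaces, with their own operations. Their
  elements share a type, but the carriers may overlap arbitrarily.\<close>

record ('o, 'm, 'k, 'v) rep =
  Space :: "'o \<Rightarrow> ('k, 'v) module"
  Act :: "'m \<Rightarrow> 'v \<Rightarrow> 'v"

definition cat_representation ::
  "('o, 'm) cat \<Rightarrow> 'k ring \<Rightarrow> ('o, 'm, 'k, 'v) rep \<Rightarrow> bool" where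
  "cat_representation C K M \<longleftrightarrow>
     (\<forall>x\<in>Obj C. vectorspace K (Space M x)) \<and>
     (\<forall>f\<in>Mor C. linear_map K (Space M (Dom C f)) (Space M (Cod C f)) (Act M f)) \<and>
     (\<forall>x\<in>Obj C. \<forall>v\<in>carrier (Space M x). Act M (Ident C x) v = v) \<and>
     (\<forall>x y z. \<forall>f\<in>Hom C x y. \<forall>g\<in>Hom C y z. \<forall>v\<in>carrier (Space M x).
        Act M (g \<cdot>\<^bsub>C\<^esub> f) v = Act M g (Act M f v))"

definition subrepresentation ::
  "('o, 'm) cat \<Rightarrow> 'k ring \<Rightarrow> ('o, 'm, 'k, 'v) rep \<Rightarrow> ('o \<Rightarrow> 'v set) \<Rightarrow> bool" where
  "subrepresentation C K M N \<longleftrightarrow>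
     (\<forall>x\<in>Obj C. VectorSpace.subspace K (N x) (Space M x)) \<and>
     (\<forall>f\<in>Mor C. Act M f ` N (Dom C f) \<subseteq> N (Cod C f))"

definition finitely_generated ::
  "('o, 'm) cat \<Rightarrow> 'k ring \<Rightarrow> ('o, 'm, 'k, 'v) rep \<Rightarrow> bool" where
  "finitely_generated C K M \<longleftrightarrow>
     (\<exists>S. finite S \<and> S \<subseteq> Sigma (Obj C) (\<lambda>x. carrier (Space M x)) \<and>
        (\<forall>N. subrepresentation C K M N \<and> (\<forall>(x, v)\<in>S. v \<in> N x) \<longrightarrow>
             (\<forall>x\<in>Obj C. N x = carrier (Space M x))))"

text \<open>Isomorphic objects have isomorphic spaces, so the choice of a representative is immaterial.\<close>

definition class_dim :: "'k ring \<Rightarrow> ('o, 'm, 'k, 'v) rep \<Rightarrow> 'o set \<Rightarrow> nat" where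
  "class_dim K M c = vectorspace.dim K (Space M (SOME x. x \<in> c))"

definition norm_fibre ::
  "('o, 'm) cat \<Rightarrow> ('o set \<Rightarrow> nat) \<Rightarrow> 'k ring \<Rightarrow> ('o, 'm, 'k, 'v) rep \<Rightarrow> nat \<Rightarrow> 'o set set" where
  "norm_fibre C \<nu> K M n = {c \<in> iso_classes C. \<nu> c = n \<and> class_dim K M c \<noteq> 0}"

text \<open>The Hilbert series is meaningful only if all spaces are finite-dimensional and each coefficient
  is a sum with finitely many nonzero terms; \<open>hilbert_series\<close> is a junk value otherwise.\<close>

definition hilbert_defined ::
  "('o, 'm) cat \<Rightarrow> ('o set \<Rightarrow> nat) \<Rightarrow> 'k ring \<Rightarrow> ('o, 'm, 'k, 'v) rep \<Rightarrow> bool" where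
  "hilbert_defined C \<nu> K M \<longleftrightarrow>
     (\<forall>x\<in>Obj C. vectorspace.fin_dim K (Space M x)) \<and> (\<forall>n. finite (norm_fibre C \<nu> K M n))"

definition hilbert_series ::
  "('o, 'm) cat \<Rightarrow> ('o set \<Rightarrow> nat) \<Rightarrow> 'k ring \<Rightarrow> ('o, 'm, 'k, 'v) rep \<Rightarrow> int fps" where
  "hilbert_series C \<nu> K M = Abs_fps (\<lambda>n. \<Sum>c\<in>norm_fibre C \<nu> K M n. int (class_dim K M c))"

end

theory Submission
  imports Defs
begin

text \<open>Let \<open>v\<^sub>i\<close> at \<open>x\<^sub>i\<close> (\<open>i < m\<close>) generate \<open>M\<close>. Order the pairs \<open>(i, f)\<close> with \<open>f\<close> from \<open>x\<^sub>i\<close> to \<open>y\<close>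
  lexicographically, using the admissible order for fixed \<open>i\<close>. Those pairs for which \<open>M(f) v\<^sub>i\<close> is
  not in the span of the earlier vectors index a basis of \<open>M(y)\<close>. The remaining morphisms, for
  fixed \<open>i\<close>, form an ideal \<open>J\<^sub>i\<close> because postcomposition preserves the order. So the Hilbert series
  of \<open>M\<close> is the sum over \<open>i\<close> of the series of all morphism classes out of \<open>x\<^sub>i\<close> minus that of \<open>J\<^sub>i\<close>.
  All sets counted are finite because only finitely many words have a given length.\<close>

section \<open>Bases from ordered families\<close>

context vectorspace
begin

text \<open>The greedy basis: a vector is kept exactly when it is new relative to the vectors before
  it. The induction removes the greatest index, so that the kept vectors among the remaining indices
  do not change.\<close>

lemma basis_of_ordered_family:
  fixes u :: "'i \<Rightarrow> 'c" and less :: "'i \<Rightarrow> 'i \<Rightarrow> bool"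
  assumes "finite A" and "asymp_on A less" and "transp_on A less" and "totalp_on A less"
    and "u ` A \<subseteq> carrier V"
  shows "\<exists>B. finite B \<and> B \<subseteq> carrier V \<and> lin_indpt B \<and> span B = span (u ` A) \<and>
    card B = card {a \<in> A. u a \<notin> span (u ` {b \<in> A. less b a})}"
  using assms
proof (induction A rule: finite_psubset_induct)
  case (psubset A)
  show ?case
  proof (cases "A = {}")
    case True
    have "lin_indpt {}" by (simp add: lin_dep_def)
    then show ?thesis using True by (intro exI[of _ "{}"]) simp
  next
    case False
    \<comment> \<open>Asymmetry and transitivity give a maximal element; totality makes it the
      greatest one, which is the content of \<open>below_m\<close>.\<close>
    obtain m where m: "m \<in> A" "\<And>a. a \<in> A \<Longrightarrow> a \<noteq> m \<Longrightarrow> \<not> less m a"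
      using Finite_Set.bex_max_element[OF psubset.hyps psubset.prems(1,2) False] by blast
    define A' where "A' = A - {m}"
    have A': "A' \<subset> A" "A' \<subseteq> A" "m \<notin> A'" "A = insert m A'" using m(1) by (auto simp: A'_def)
    have below_m: "{b \<in> A. less b m} = A'"
    proof -
      have "less b m" if "b \<in> A'" for b
        using that m totalp_onD[OF psubset.prems(3), of b m] by (auto simp: A'_def)
      moreover have "\<not> less m m" using asymp_onD[OF psubset.prems(1) m(1) m(1)] by blast
      ultimately show ?thesis by (auto simp: A'_def)
    qed
    have below: "{b \<in> A. less b a} = {b \<in> A'. less b a}" if "a \<in> A'" for a
      using m that by (auto simp: A'_def)
    let ?G = "\<lambda>A. {a \<in> A. u a \<notin> span (u ` {b \<in> A. less b a})}"
    \<comment> \<open>The other indices keep their predecessors by \<open>below\<close>, so only the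
      status of \<open>m\<close> has to be decided.\<close>
    have G: "?G A = (if u m \<in> span (u ` A') then ?G A' else insert m (?G A'))"
    proof (rule Set.set_eqI)
      fix a
      consider "a = m" | "a \<in> A'" | "a \<notin> A" using A'(4) by blast
      then show "a \<in> ?G A \<longleftrightarrow> a \<in> (if u m \<in> span (u ` A') then ?G A' else insert m (?G A'))"
      proof cases
        case 1
        have "m \<in> ?G A \<longleftrightarrow> u m \<notin> span (u ` A')" using m(1) below_m by simp
        then show ?thesis using 1 A'(3) by simp
      next
        case 2
        then have "a \<in> A" "a \<noteq> m" using A'(2,3) by auto
        then show ?thesis using 2 below[OF 2] by simp
      next
        case 3
        then have "a \<notin> A'" "a \<noteq> m" using A'(2) m(1) by auto
        then show ?thesis using 3 by simp
      qed
    qed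
    have A'V: "u ` A' \<subseteq> carrier V" and mV: "u m \<in> carrier V"
      using psubset.prems(4) A'(2) m(1) by auto
    obtain B where B: "finite B" "B \<subseteq> carrier V" "lin_indpt B" "span B = span (u ` A')"
      "card B = card (?G A')"
      using psubset.IH[OF A'(1) asymp_on_subset[OF psubset.prems(1) A'(2)]
          transp_on_subset[OF psubset.prems(2) A'(2)] totalp_on_subset[OF psubset.prems(3) A'(2)]
          A'V] by blast
    have uA: "u ` A = u ` A' \<union> {u m}" using A'(4) by auto
    show ?thesis
    proof (cases "u m \<in> span (u ` A')")
      case True
      then have "span (u ` A) = span (u ` A')" using already_in_span[OF A'V True] uA by simp
      then show ?thesis using B G True by (intro exI[of _ B]) simp
    next
      case nspan: False
      \<comment> \<open>Since \<open>B\<close> is contained in its span, a vector outside the span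
        is a genuinely new element; this makes the cardinality grow by one.\<close>
      have "u m \<notin> B" using in_own_span[OF B(2)] B(4) nspan by auto
      moreover from this have "lin_indpt (B \<union> {u m})"
        using lin_dep_iff_in_span[OF B(2,3) mV] nspan B(4) by simp
      moreover have "span (B \<union> {u m}) = span (u ` A)"
        unfolding uA using span_Un[OF B(2) A'V B(4), of "{u m}" "{u m}"] mV by simp
      moreover have "card (?G A) = Suc (card (?G A'))"
        using G nspan A'(3) finite_subset[OF A'(2) psubset.hyps] by simp
      ultimately show ?thesis
        using B mV by (intro exI[of _ "B \<union> {u m}"]) simp
    qed
  qed
qed

lemma dim_ordered_spanning_family:
  fixes u :: "'i \<Rightarrow> 'c" and less :: "'i \<Rightarrow> 'i \<Rightarrow> bool"
  assumes "finite A" and "asymp_on A less" and "transp_on A less" and "totalp_on A less"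
    and "u ` A \<subseteq> carrier V" and "span (u ` A) = carrier V"
  shows "fin_dim" and "dim = card {a \<in> A. u a \<notin> span (u ` {b \<in> A. less b a})}"
proof -
  show fin_dim unfolding fin_dim_def using assms by blast
  obtain B where "finite B" "B \<subseteq> carrier V" "lin_indpt B" "span B = carrier V"
    "card B = card {a \<in> A. u a \<notin> span (u ` {b \<in> A. less b a})}"
    using basis_of_ordered_family[OF assms(1-5)] assms(6) by auto
  then show "dim = card {a \<in> A. u a \<notin> span (u ` {b \<in> A. less b a})}"
    using dim_basis by (simp add: basis_def)
qed

end

text \<open>The preimage of \<open>N\<close> is a submodule containing \<open>S\<close>, hence
  contains the span of \<open>S\<close>.\<close>

lemma (in linear_map) image_span_subset:
  assumes S: "S \<subseteq> carrier V" and N: "submodule K N W" and SN: "T ` S \<subseteq> N"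
  shows "T ` V.module.span S \<subseteq> N"
proof -
  interpret N: submodule K N W by (rule N)
  have "submodule K {v \<in> carrier V. T v \<in> N} V"
    by unfold_locales auto
  then have "V.module.span S \<subseteq> {v \<in> carrier V. T v \<in> N}"
    using S SN by (intro V.module.span_is_subset) auto
  then show ?thesis by auto
qed

section \<open>Isomorphism classes of morphisms\<close>

context category
begin

text \<open>Unpacks an isomorphism in \<open>coslice C x\<close>, whose morphisms are triples, into
  two mutually inverse morphisms of \<open>C\<close> between the codomains.\<close>

lemma mem_mor_class:
  "g \<in> mor_class C x f \<longleftrightarrow> f \<in> Mor C \<and> Dom C f = x \<and> g \<in> Mor C \<and> Dom C g = x \<and>
    (\<exists>h\<in>Hom C (Cod C f) (Cod C g). \<exists>k\<in>Hom C (Cod C g) (Cod C f).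
       g = h \<cdot> f \<and> f = k \<cdot> g \<and> k \<cdot> h = Ident C (Cod C f) \<and> h \<cdot> k = Ident C (Cod C g))"
  (is "_ \<longleftrightarrow> ?R")
proof
  assume "g \<in> mor_class C x f"
  then have "(f, g) \<in> iso_rel (coslice C x)" by (simp add: iso_class_def)
  then obtain p q where p: "p \<in> Hom (coslice C x) f g" and q: "q \<in> Hom (coslice C x) g f"
    and e: "q \<cdot>\<^bsub>coslice C x\<^esub> p = Ident (coslice C x) f" "p \<cdot>\<^bsub>coslice C x\<^esub> q = Ident (coslice C x) g"
    unfolding iso_rel_def by blast
  obtain a h b where p': "p = (a, h, b)" by (cases p)
  obtain a' k b' where q': "q = (a', k, b')" by (cases q)
  have a: "f \<in> Mor C" "Dom C f = x" "g \<in> Mor C" "Dom C g = x"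
    "h \<in> Hom C (Cod C f) (Cod C g)" "g = h \<cdot> f"
    using p unfolding p' coslice_hom_iff by blast+
  have b: "k \<in> Hom C (Cod C g) (Cod C f)" "f = k \<cdot> g"
    using q unfolding q' coslice_hom_iff by blast+
  have c: "k \<cdot> h = Ident C (Cod C f)" "h \<cdot> k = Ident C (Cod C g)"
    using e by (simp_all add: p' q' coslice_comp coslice_ident)
  show ?R
    by (intro conjI bexI[of _ h] bexI[of _ k]) (fact a b c)+
next
  assume ?R
  then obtain h k where a: "f \<in> Mor C" "Dom C f = x" "g \<in> Mor C" "Dom C g = x"
    "h \<in> Hom C (Cod C f) (Cod C g)" "k \<in> Hom C (Cod C g) (Cod C f)"
    "g = h \<cdot> f" "f = k \<cdot> g" "k \<cdot> h = Ident C (Cod C f)" "h \<cdot> k = Ident C (Cod C g)" by blast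
  have "(f, h, g) \<in> Hom (coslice C x) f g" "(g, k, f) \<in> Hom (coslice C x) g f"
    unfolding coslice_hom_iff using a by blast+
  moreover have "(g, k, f) \<cdot>\<^bsub>coslice C x\<^esub> (f, h, g) = Ident (coslice C x) f"
    "(f, h, g) \<cdot>\<^bsub>coslice C x\<^esub> (g, k, f) = Ident (coslice C x) g"
    unfolding coslice_comp coslice_ident by (simp_all only: a(9,10))
  moreover have "f \<in> Obj (coslice C x)" "g \<in> Obj (coslice C x)" using a(1-4) by (simp_all add: coslice_def)
  ultimately show "g \<in> mor_class C x f" unfolding iso_class_def iso_rel_def by blast
qed

lemma mor_classes_eq: "mor_classes C x = mor_class C x ` {f \<in> Mor C. Dom C f = x}"
  by (auto simp: iso_classes_def quotient_def iso_class_def coslice_def)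

lemma mor_class_in_classes: "f \<in> Hom C x y \<Longrightarrow> mor_class C x f \<in> mor_classes C x"
  unfolding mor_classes_eq by (auto simp: Hom_def)

lemma mor_class_self: "f \<in> Hom C x y \<Longrightarrow> f \<in> mor_class C x f"
  unfolding iso_class_def
  using equiv_class_self[OF category.equiv_iso_rel[OF category_coslice, of x], of f]
  by (simp add: coslice_def Hom_def)

lemma mor_class_eqI: "g \<in> mor_class C x f \<Longrightarrow> mor_class C x g = mor_class C x f"
  unfolding iso_class_def
  using equiv_class_eq[OF category.equiv_iso_rel[OF category_coslice, of x], of f g] by simp

lemma mor_classesE:
  assumes "F \<in> mor_classes C x" "g \<in> F"
  shows "g \<in> Hom C x (Cod C g)" "F = mor_class C x g"
proof -
  obtain f where f: "F = mor_class C x f" using assms by (auto simp: mor_classes_eq)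
  show "F = mor_class C x g" using mor_class_eqI assms f by blast
  show "g \<in> Hom C x (Cod C g)" using assms(2) unfolding f mem_mor_class by (simp add: Hom_def)
qed

lemma iso_class_eq_iff:
  "y \<in> Obj C \<Longrightarrow> z \<in> Obj C \<Longrightarrow> iso_class C y = iso_class C z \<longleftrightarrow> (y, z) \<in> iso_rel C"
  unfolding iso_class_def using eq_equiv_class_iff[OF equiv_iso_rel] by blast

text \<open>Needed because \<open>class_dim\<close> evaluates a representation at an object picked
  by \<open>SOME\<close>.\<close>

lemma iso_class_some:
  assumes "c \<in> iso_classes C"
  shows "(SOME y. y \<in> c) \<in> Obj C" "iso_class C (SOME y. y \<in> c) = c"
proof -
  obtain z where z: "z \<in> Obj C" "c = iso_rel C `` {z}"
    using assms unfolding iso_classes_def by (auto elim: quotientE)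
  have "z \<in> c" using z equiv_class_self[OF equiv_iso_rel] by blast
  then have s: "(SOME y. y \<in> c) \<in> c" by (rule someI)
  then have r: "(z, SOME y. y \<in> c) \<in> iso_rel C" using z(2) by blast
  show "iso_class C (SOME y. y \<in> c) = c"
    unfolding iso_class_def
    by (rule trans[OF equiv_class_eq[OF equiv_iso_rel r, symmetric] z(2)[symmetric]])
  show "(SOME y. y \<in> c) \<in> Obj C" using r by (simp add: iso_rel_def)
qed

end

section \<open>Standard terms\<close>

text \<open>Fixes the choices whose existence the hypotheses supply: an enumeration of the
  generators and, at the object of each generator, an admissible order and a lingual structure. Only
  indices below \<open>m\<close> are meaningful.\<close>

locale generated_representation = category C
  for C :: "('o, 'm) cat" (structure) +
  fixes K :: "'k ring" and M :: "('o, 'm, 'k, 'v) rep"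
    and \<nu> :: "'o set \<Rightarrow> nat" and P :: "'a lang set"
    and m :: nat and x :: "nat \<Rightarrow> 'o" and v :: "nat \<Rightarrow> 'v"
    and R :: "nat \<Rightarrow> ('m set \<times> 'm set) set" and \<Sigma> :: "nat \<Rightarrow> 'a set"
    and \<iota> :: "nat \<Rightarrow> 'm set \<Rightarrow> 'a list"
  assumes directed: "y \<in> Obj C \<Longrightarrow> f \<in> Hom C y y \<Longrightarrow> f = Ident C y"
    and rep: "cat_representation C K M"
    and gen_obj: "i < m \<Longrightarrow> x i \<in> Obj C"
    and gen_carrier: "i < m \<Longrightarrow> v i \<in> carrier (Space M (x i))"
    and generates: "subrepresentation C K M N \<Longrightarrow> (\<And>i. i < m \<Longrightarrow> v i \<in> N (x i)) \<Longrightarrow> y \<in> Obj C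
      \<Longrightarrow> N y = carrier (Space M y)"
    and admissible: "i < m \<Longrightarrow> admissible_order C (x i) (R i)"
    and lingual: "i < m \<Longrightarrow> lingual_structure P C \<nu> (x i) (\<Sigma> i) (\<iota> i)"
begin

section \<open>Terms, their order, and leading terms of relations\<close>

definition terms :: "'o \<Rightarrow> (nat \<times> 'm) set" where
  "terms y = {(i, f). i < m \<and> f \<in> Hom C (x i) y}"

definition vec :: "nat \<times> 'm \<Rightarrow> 'v" where
  "vec p = Act M (snd p) (v (fst p))"

text \<open>The position-over-term order known from Groebner bases of modules. It is a strict total
  order among terms with a common codomain; it cannot separate a term from its composite with an
  isomorphism.\<close>

definition before :: "nat \<times> 'm \<Rightarrow> nat \<times> 'm \<Rightarrow> bool" where
  "before p q \<longleftrightarrow> fst p < fst q \<or> fst p = fst q \<and>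
     (mor_class C (x (fst p)) (snd p), mor_class C (x (fst q)) (snd q)) \<in> R (fst p) - Id"

text \<open>Says that \<open>(i, f)\<close> is the leading term of a linear relation among the
  vectors of terms. Span membership expresses this without constructing the free representation and
  its subrepresentation of relations.\<close>

definition leading :: "nat \<Rightarrow> 'm \<Rightarrow> bool" where
  "leading i f \<longleftrightarrow> vec (i, f) \<in> LinearCombinations.module.span K (Space M (Cod C f))
     (vec ` {q \<in> terms (Cod C f). before q (i, f)})"

text \<open>The existential is harmless: \<open>leading_mor_class\<close> shows that all members of
  a class agree.\<close>

definition leading_ideal :: "nat \<Rightarrow> 'm set set" where
  "leading_ideal i = {F \<in> mor_classes C (x i). \<exists>f\<in>F. leading i f}"

definition standard_terms :: "'o \<Rightarrow> (nat \<times> 'm) set" where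
  "standard_terms y = {p \<in> terms y. \<not> leading (fst p) (snd p)}"

lemma space: "y \<in> Obj C \<Longrightarrow> vectorspace K (Space M y)"
  using rep by (simp add: cat_representation_def)

lemma act_linear:
  "f \<in> Hom C y z \<Longrightarrow> linear_map K (Space M y) (Space M z) (Act M f)"
  using rep by (auto simp: cat_representation_def Hom_def)

lemma hom_obj: "f \<in> Hom C y z \<Longrightarrow> y \<in> Obj C" "f \<in> Hom C y z \<Longrightarrow> z \<in> Obj C"
  using dom_obj cod_obj by (auto simp: Hom_def)

lemma vec_carrier: "p \<in> terms y \<Longrightarrow> vec p \<in> carrier (Space M y)"
proof -
  assume p: "p \<in> terms y"
  then have "snd p \<in> Hom C (x (fst p)) y" "fst p < m" by (auto simp: terms_def)
  then interpret linear_map K "Space M (x (fst p))" "Space M y" "Act M (snd p)"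
    using act_linear by blast
  show ?thesis unfolding vec_def using gen_carrier[OF \<open>fst p < m\<close>] by (rule T_im)
qed

section \<open>Postcomposition of terms and relations\<close>

lemma terms_comp:
  assumes "h \<in> Hom C y z" "(i, f) \<in> terms y"
  shows "(i, h \<cdot> f) \<in> terms z" "vec (i, h \<cdot> f) = Act M h (vec (i, f))"
proof -
  have f: "f \<in> Hom C (x i) y" "i < m" using assms(2) by (auto simp: terms_def)
  show "(i, h \<cdot> f) \<in> terms z" using f assms(1) comp_hom by (simp add: terms_def)
  show "vec (i, h \<cdot> f) = Act M h (vec (i, f))"
    using rep f assms(1) gen_carrier[OF f(2)] by (auto simp: vec_def cat_representation_def)
qed

text \<open>Postcomposition leaves the generator index alone, so only equal indices matter, and
  there this is admissibility.\<close>

lemma before_comp: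
  assumes "h \<in> Hom C y z" "(i, f) \<in> terms y" "(j, g) \<in> terms y" "before (j, g) (i, f)"
  shows "before (j, h \<cdot> g) (i, h \<cdot> f)"
proof (cases "j < i")
  case False
  with assms(4) have "j = i" "(mor_class C (x i) g, mor_class C (x i) f) \<in> R i - Id"
    by (auto simp: before_def)
  moreover have "admissible_order C (x i) (R i)" "g \<in> Hom C (x i) y" "f \<in> Hom C (x i) y"
    using assms admissible \<open>j = i\<close> by (auto simp: terms_def)
  ultimately have "(mor_class C (x i) (h \<cdot> g), mor_class C (x i) (h \<cdot> f)) \<in> R i - Id"
    using assms(1) unfolding admissible_order_def by blast
  then show ?thesis using \<open>j = i\<close> by (simp add: before_def)
qed (simp add: before_def)

text \<open>Apply \<open>Act M h\<close> to a relation that expresses \<open>vec (i, f)\<close> by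
  earlier terms: by \<open>before_comp\<close> the images are terms before
  \<open>(i, h \<cdot> f)\<close>.\<close>

lemma leading_comp:
  assumes h: "h \<in> Hom C y z" and f: "(i, f) \<in> terms y" and lead: "leading i f"
  shows "leading i (h \<cdot> f)"
proof -
  have cod: "Cod C f = y" "Cod C (h \<cdot> f) = z"
    using f comp_hom[OF _ h] by (auto simp: terms_def Hom_def)
  interpret linear_map K "Space M y" "Space M z" "Act M h" by (rule act_linear[OF h])
  let ?A = "{q \<in> terms y. before q (i, f)}" and ?B = "{q \<in> terms z. before q (i, h \<cdot> f)}"
  have A: "vec ` ?A \<subseteq> carrier (Space M y)" and B: "vec ` ?B \<subseteq> carrier (Space M z)"
    using vec_carrier by auto
  have "Act M h ` vec ` ?A \<subseteq> vec ` ?B"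
  proof clarify
    fix j g assume q: "(j, g) \<in> terms y" "before (j, g) (i, f)"
    have "(j, h \<cdot> g) \<in> ?B" using terms_comp[OF h q(1)] before_comp[OF h f q] by simp
    then show "Act M h (vec (j, g)) \<in> vec ` ?B"
      using terms_comp(2)[OF h q(1)] by (metis (no_types, lifting) imageI)
  qed
  then have "Act M h ` vec ` ?A \<subseteq> W.module.span (vec ` ?B)" using W.module.in_own_span[OF B] by blast
  then have "Act M h ` V.module.span (vec ` ?A) \<subseteq> W.module.span (vec ` ?B)"
    by (rule image_span_subset[OF A W.module.span_is_submodule[OF B]])
  then show ?thesis
    using lead terms_comp(2)[OF h f] unfolding leading_def cod by auto
qed

section \<open>Finiteness and total order of the terms at one object\<close>

text \<open>This is where directedness enters: an isomorphism between parallel morphisms is an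
  endomorphism of their codomain, hence an identity. Terms at one object can therefore be replaced
  by classes, which carry orders and words.\<close>

lemma mor_class_inj:
  assumes "f \<in> Hom C w y" "g \<in> Hom C w y" "mor_class C w f = mor_class C w g"
  shows "f = g"
proof -
  have "f \<in> mor_class C w g" using mor_class_self assms by blast
  then obtain h where h: "h \<in> Hom C (Cod C g) (Cod C f)" "f = h \<cdot> g"
    unfolding mem_mor_class by blast
  have "Cod C f = y" "Cod C g = y" using assms by (auto simp: Hom_def)
  then have "h = Ident C y" using h(1) directed hom_obj by simp
  then show ?thesis using h(2) ident_comp[OF assms(2)] by simp
qed

lemma words:
  assumes "i < m"
  shows "finite (\<Sigma> i)" "\<iota> i ` mor_classes C (x i) \<subseteq> lists (\<Sigma> i)"
    "inj_on (\<iota> i) (mor_classes C (x i))"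
    "f \<in> Hom C (x i) y \<Longrightarrow> length (\<iota> i (mor_class C (x i) f)) = \<nu> (iso_class C y)"
  using lingual[OF assms] unfolding lingual_structure_def by auto

lemma finite_classes_of_length:
  assumes "i < m"
  shows "finite {F \<in> mor_classes C (x i). length (\<iota> i F) = n}"
proof (rule inj_on_finite[of "\<iota> i"])
  show "inj_on (\<iota> i) {F \<in> mor_classes C (x i). length (\<iota> i F) = n}"
    using words(3)[OF assms] by (rule inj_on_subset) auto
  show "\<iota> i ` {F \<in> mor_classes C (x i). length (\<iota> i F) = n} \<subseteq> {w. set w \<subseteq> \<Sigma> i \<and> length w = n}"
    using words(2)[OF assms] by auto
  show "finite {w. set w \<subseteq> \<Sigma> i \<and> length w = n}"
    using finite_lists_length_eq[OF words(1)[OF assms]] .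
qed

text \<open>Passing to classes is injective here, and all resulting words have length
  \<open>\<nu> (iso_class C y)\<close>; over a finite alphabet there are finitely many such
  words.\<close>

lemma finite_terms: "finite (terms y)"
proof (rule inj_on_finite[of "\<lambda>(i, f). (i, mor_class C (x i) f)"])
  let ?T = "SIGMA i:{..<m}. {F \<in> mor_classes C (x i). length (\<iota> i F) = \<nu> (iso_class C y)}"
  show "inj_on (\<lambda>(i, f). (i, mor_class C (x i) f)) (terms y)"
    by (auto simp: inj_on_def terms_def intro: mor_class_inj)
  show "(\<lambda>(i, f). (i, mor_class C (x i) f)) ` terms y \<subseteq> ?T"
    using words(4) mor_class_in_classes by (auto simp: terms_def)
  show "finite ?T" by (rule finite_SigmaI) (auto intro: finite_classes_of_length)
qed

lemma before_linear:
  "asymp_on (terms y) before" "transp_on (terms y) before" "totalp_on (terms y) before"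
proof -
  have R: "trans (R i)" "antisym (R i)" "total_on (mor_classes C (x i)) (R i)" if "i < m" for i
    using admissible[OF that]
    by (auto simp: admissible_order_def well_order_on_def linear_order_on_def partial_order_on_def
        preorder_on_def)
  show "asymp_on (terms y) before"
  proof (rule asymp_onI)
    fix p q assume a: "p \<in> terms y" "before p q"
    obtain i f j g where e: "p = (i, f)" "q = (j, g)" by (cases p, cases q)
    have "i < m" using a(1) e by (simp add: terms_def)
    then show "\<not> before q p" using a(2) antisymD[OF R(2)] unfolding before_def e by auto
  qed
  show "transp_on (terms y) before"
  proof (rule transp_onI)
    fix p q r assume a: "p \<in> terms y" "before p q" "before q r"
    obtain i f j g k h where e: "p = (i, f)" "q = (j, g)" "r = (k, h)" by (cases p, cases q, cases r)
    have m: "i < m" using a(1) e by (simp add: terms_def)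
    \<comment> \<open>If \<open>X = Z\<close>, the two pairs would be opposite and antisymmetry
      would force \<open>X = Y\<close>.\<close>
    have step: "(X, Z) \<in> R i - Id" if "(X, Y) \<in> R i - Id" "(Y, Z) \<in> R i - Id" for X Y Z
      using that transD[OF R(1)[OF m], of X Y Z] antisymD[OF R(2)[OF m], of X Y] by auto
    show "before p r"
    proof (cases "i = j \<and> j = k")
      case True
      then have e': "p = (i, f)" "q = (i, g)" "r = (i, h)" using e by simp_all
      let ?F = "mor_class C (x i)"
      have "(?F f, ?F g) \<in> R i - Id" "(?F g, ?F h) \<in> R i - Id"
        using a(2,3) unfolding before_def e' by simp_all
      then have "(?F f, ?F h) \<in> R i - Id"
        by (rule step)
      then show ?thesis by (simp add: before_def e')
    next
      case False
      then show ?thesis using a(2,3) unfolding before_def e by auto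
    qed
  qed
  show "totalp_on (terms y) before"
  proof (rule totalp_onI)
    fix p q assume a: "p \<in> terms y" "q \<in> terms y" "p \<noteq> q"
    obtain i f j g where e: "p = (i, f)" "q = (j, g)" by (cases p, cases q)
    have h: "i < m" "f \<in> Hom C (x i) y" "g \<in> Hom C (x j) y" using a e by (auto simp: terms_def)
    show "before p q \<or> before q p"
    proof (cases "i = j")
      case True
      \<comment> \<open>Totality of \<open>R i\<close> compares distinct classes, so distinct terms
        must first be shown to have distinct classes.\<close>
      then have "mor_class C (x i) f \<noteq> mor_class C (x i) g" using a(3) e h mor_class_inj by blast
      moreover have "mor_class C (x i) f \<in> mor_classes C (x i)"
        "mor_class C (x i) g \<in> mor_classes C (x i)"
        using h True mor_class_in_classes by blast+
      ultimately show ?thesis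
        using R(3)[OF h(1)] True unfolding total_on_def before_def e by auto
    qed (auto simp: before_def e)
  qed
qed

section \<open>Dimensions as numbers of standard terms\<close>

text \<open>Finite generation is stated through minimality among subrepresentations, so the spans of
  the terms must be recognised as one before \<open>generates\<close> applies.\<close>

lemma subrepresentation_span_terms:
  "subrepresentation C K M (\<lambda>y. LinearCombinations.module.span K (Space M y) (vec ` terms y))"
  unfolding subrepresentation_def
proof (intro conjI ballI)
  fix y assume "y \<in> Obj C"
  then interpret vectorspace K "Space M y" by (rule space)
  show "VectorSpace.subspace K (span (vec ` terms y)) (Space M y)"
    by (rule span_is_subspace) (use vec_carrier in auto)
next
  fix f assume "f \<in> Mor C"
  then have f: "f \<in> Hom C (Dom C f) (Cod C f)" by (simp add: Hom_def)
  then interpret linear_map K "Space M (Dom C f)" "Space M (Cod C f)" "Act M f" by (rule act_linear)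
  have A: "vec ` terms (Dom C f) \<subseteq> carrier (Space M (Dom C f))"
    and B: "vec ` terms (Cod C f) \<subseteq> carrier (Space M (Cod C f))" using vec_carrier by auto
  have "Act M f (vec (i, g)) \<in> vec ` terms (Cod C f)" if "(i, g) \<in> terms (Dom C f)" for i g
    using terms_comp[OF f that] by (metis imageI)
  then have "Act M f ` vec ` terms (Dom C f) \<subseteq> W.module.span (vec ` terms (Cod C f))"
    using W.module.in_own_span[OF B] by auto
  then show "Act M f ` V.module.span (vec ` terms (Dom C f)) \<subseteq> W.module.span (vec ` terms (Cod C f))"
    by (rule image_span_subset[OF A W.module.span_is_submodule[OF B]])
qed

text \<open>The identity terms put every generator into the subrepresentation spanned by
  terms.\<close>

lemma span_terms:
  assumes y: "y \<in> Obj C"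
  shows "LinearCombinations.module.span K (Space M y) (vec ` terms y) = carrier (Space M y)"
proof (rule generates[OF subrepresentation_span_terms _ y])
  fix i assume i: "i < m"
  interpret vectorspace K "Space M (x i)" by (rule space[OF gen_obj[OF i]])
  have "(i, Ident C (x i)) \<in> terms (x i)" using i ident_hom gen_obj by (simp add: terms_def)
  moreover have "vec (i, Ident C (x i)) = v i"
    using rep gen_obj[OF i] gen_carrier[OF i] by (simp add: vec_def cat_representation_def)
  ultimately have "v i \<in> vec ` terms (x i)" by (metis imageI)
  moreover have "vec ` terms (x i) \<subseteq> carrier (Space M (x i))" using vec_carrier by auto
  ultimately show "v i \<in> span (vec ` terms (x i))" using in_own_span by blast
qed

lemma dim_space:
  assumes y: "y \<in> Obj C"
  shows "vectorspace.fin_dim K (Space M y)"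
    and "vectorspace.dim K (Space M y) = card (standard_terms y)"
proof -
  interpret vectorspace K "Space M y" by (rule space[OF y])
  have V: "vec ` terms y \<subseteq> carrier (Space M y)" using vec_carrier by auto
  note d = dim_ordered_spanning_family[OF finite_terms before_linear V span_terms[OF y]]
  show fin_dim by (rule d(1))
  \<comment> \<open>In \<open>leading\<close> the span is taken at \<open>Cod C f\<close>, which is
    \<open>y\<close> for every term in \<open>terms y\<close>.\<close>
  have "standard_terms y = {p \<in> terms y. vec p \<notin> span (vec ` {q \<in> terms y. before q p})}"
    unfolding standard_terms_def leading_def terms_def by (auto simp: Hom_def)
  then show "dim = card (standard_terms y)" using d(2) by simp
qed

section \<open>The ideals of leading classes and their languages\<close>

text \<open>An isomorphism in the coslice is in particular a postcomposition, so
  \<open>leading_comp\<close> applies.\<close>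

lemma leading_mor_class:
  assumes "i < m" "g \<in> mor_class C (x i) f" "leading i f"
  shows "leading i g"
proof -
  obtain h where h: "h \<in> Hom C (Cod C f) (Cod C g)" "g = h \<cdot> f"
    and f: "f \<in> Mor C" "Dom C f = x i"
    using assms(2) unfolding mem_mor_class by blast
  have "(i, f) \<in> terms (Cod C f)" using f assms(1) by (simp add: terms_def Hom_def)
  then show ?thesis using leading_comp[OF h(1) _ assms(3)] h(2) by simp
qed

lemma mor_class_in_leading_ideal:
  assumes "i < m" "f \<in> Hom C (x i) y"
  shows "mor_class C (x i) f \<in> leading_ideal i \<longleftrightarrow> leading i f"
proof
  assume "mor_class C (x i) f \<in> leading_ideal i"
  then obtain g where g: "g \<in> mor_class C (x i) f" "leading i g" by (auto simp: leading_ideal_def)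
  have "f \<in> mor_class C (x i) g" using mor_class_eqI[OF g(1)] mor_class_self[OF assms(2)] by simp
  then show "leading i f" using leading_mor_class[OF assms(1) _ g(2)] by blast
qed (use mor_class_in_classes[OF assms(2)] mor_class_self[OF assms(2)] in
      \<open>auto simp: leading_ideal_def\<close>)

text \<open>Going up in \<open>mor_le\<close> means postcomposing, which preserves leading terms by
  \<open>leading_comp\<close>.\<close>

lemma leading_ideal_ideal:
  assumes i: "i < m"
  shows "poset_ideal (mor_classes C (x i)) (mor_le C) (leading_ideal i)"
  unfolding poset_ideal_def
proof (intro conjI ballI impI)
  show "leading_ideal i \<subseteq> mor_classes C (x i)" by (auto simp: leading_ideal_def)
next
  fix F G assume F: "F \<in> leading_ideal i" and G: "G \<in> mor_classes C (x i)" and "mor_le C F G"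
  then obtain f g h where h: "f \<in> F" "g \<in> G" "h \<in> Hom C (Cod C f) (Cod C g)" "g = h \<cdot> f"
    unfolding mor_le_def by blast
  have F': "F \<in> mor_classes C (x i)" using F by (simp add: leading_ideal_def)
  note f = mor_classesE[OF F' h(1)] and g = mor_classesE[OF G h(2)]
  have "leading i f" using F mor_class_in_leading_ideal[OF i f(1)] f(2) by simp
  moreover have "(i, f) \<in> terms (Cod C f)" using f i by (simp add: terms_def)
  ultimately have "leading i g" using leading_comp[OF h(3)] h(4) by simp
  then show "G \<in> leading_ideal i" using mor_class_in_leading_ideal[OF i g(1)] g(2) by simp
qed

lemma lang_in_class:
  assumes "i < m"
  shows "(\<Sigma> i, \<iota> i ` mor_classes C (x i)) \<in> P" "(\<Sigma> i, \<iota> i ` leading_ideal i) \<in> P"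
proof -
  \<comment> \<open>The whole poset is an ideal too, so the language of all classes also belongs to
    \<open>P\<close>.\<close>
  have "poset_ideal (mor_classes C (x i)) (mor_le C) (mor_classes C (x i))"
    by (auto simp: poset_ideal_def)
  then show "(\<Sigma> i, \<iota> i ` mor_classes C (x i)) \<in> P" "(\<Sigma> i, \<iota> i ` leading_ideal i) \<in> P"
    using lingual[OF assms] leading_ideal_ideal[OF assms] unfolding lingual_structure_def by blast+
qed

section \<open>Counting standard terms by words of fixed length\<close>

definition standard_classes :: "nat \<Rightarrow> nat \<Rightarrow> 'm set set" where
  "standard_classes n i = {F \<in> mor_classes C (x i) - leading_ideal i. length (\<iota> i F) = n}"

abbreviation representative :: "'o set \<Rightarrow> 'o" where
  "representative c \<equiv> SOME y. y \<in> c"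

lemma finite_standard_terms: "finite (standard_terms y)"
  using finite_terms by (simp add: standard_terms_def)

lemma class_dim_eq: "c \<in> iso_classes C \<Longrightarrow> class_dim K M c = card (standard_terms (representative c))"
  unfolding class_dim_def using dim_space(2) iso_class_some(1) by blast

text \<open>Exchanges the two ways of counting: by isomorphism class of the codomain, giving a
  Hilbert coefficient, and by generator, giving words of length \<open>n\<close>. Fixing one
  codomain per isomorphism class leaves exactly one term in each standard morphism class.\<close>

lemma bij_standard:
  "bij_betw (\<lambda>(c, i, f). (i, mor_class C (x i) f))
     (SIGMA c:norm_fibre C \<nu> K M n. standard_terms (representative c))
     (SIGMA i:{..<m}. standard_classes n i)"
proof (rule bij_betw_imageI)
  let ?A = "SIGMA c:norm_fibre C \<nu> K M n. standard_terms (representative c)"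
  have A: "c \<in> iso_classes C \<and> \<nu> c = n \<and> i < m \<and> f \<in> Hom C (x i) (representative c) \<and> \<not> leading i f"
    if "(c, i, f) \<in> ?A" for c i f
    using that by (auto simp: norm_fibre_def standard_terms_def terms_def)
  show "inj_on (\<lambda>(c, i, f). (i, mor_class C (x i) f)) ?A"
  proof (rule inj_onI)
    fix p q
    assume p: "p \<in> ?A" and q: "q \<in> ?A"
      and pq: "(\<lambda>(c, i, f). (i, mor_class C (x i) f)) p = (\<lambda>(c, i, f). (i, mor_class C (x i) f)) q"
    obtain c i f where pe: "p = (c, i, f)" by (cases p)
    obtain d j g where qe: "q = (d, j, g)" by (cases q)
    have ij: "j = i" and eq: "mor_class C (x i) f = mor_class C (x i) g" using pq pe qe by auto
    have cf: "(c, i, f) \<in> ?A" and dg: "(d, i, g) \<in> ?A" using p q pe qe ij by simp_all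
    note cf' = A[OF cf] and dg' = A[OF dg]
    have "g \<in> mor_class C (x i) f" using eq mor_class_self dg' by blast
    moreover have cod: "Cod C f = representative c" "Cod C g = representative d"
      using cf' dg' by (auto simp: Hom_def)
    \<comment> \<open>Isomorphic morphisms have isomorphic codomains; hence \<open>c = d\<close>,
      after which \<open>mor_class_inj\<close> applies.\<close>
    ultimately have "(representative c, representative d) \<in> iso_rel C"
      using cf' dg' iso_class_some(1) unfolding mem_mor_class iso_rel_def by auto
    then have "c = d" using cf' dg' iso_class_some iso_class_eq_iff by metis
    moreover from this have "f = g" using mor_class_inj cf' dg' eq by blast
    ultimately show "p = q" using pe qe ij by simp
  qed
  show "(\<lambda>(c, i, f). (i, mor_class C (x i) f)) ` ?A = (SIGMA i:{..<m}. standard_classes n i)"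
  proof (intro subset_antisym image_subsetI subsetI)
    fix p assume p: "p \<in> ?A"
    obtain c i f where pe: "p = (c, i, f)" by (cases p)
    note a = A[OF p[unfolded pe]]
    then have "mor_class C (x i) f \<in> standard_classes n i"
      using mor_class_in_leading_ideal mor_class_in_classes words(4) iso_class_some(2)
      by (auto simp: standard_classes_def)
    then show "(case p of (c, i, f) \<Rightarrow> (i, mor_class C (x i) f)) \<in> (SIGMA i:{..<m}. standard_classes n i)"
      using a pe by simp
  next
    fix q assume "q \<in> (SIGMA i:{..<m}. standard_classes n i)"
    then obtain i F where q: "q = (i, F)" and i: "i \<in> {..<m}" and F: "F \<in> standard_classes n i"
      by blast
    from i F have i: "i < m" and Fc: "F \<in> mor_classes C (x i)" "F \<notin> leading_ideal i"
      and len: "length (\<iota> i F) = n"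
      by (auto simp: standard_classes_def)
    obtain f where f: "f \<in> Hom C (x i) (Cod C f)" "F = mor_class C (x i) f"
      using Fc(1) unfolding mor_classes_eq by (auto simp: Hom_def)
    define c where "c = iso_class C (Cod C f)"
    have c: "c \<in> iso_classes C"
      unfolding c_def iso_classes_def iso_class_def using hom_obj(2)[OF f(1)] by (rule quotientI)
    have "iso_class C (Cod C f) = iso_class C (representative c)"
      using iso_class_some(2)[OF c] c_def by simp
    then have "(Cod C f, representative c) \<in> iso_rel C"
      using iso_class_eq_iff hom_obj(2)[OF f(1)] iso_class_some(1)[OF c] by blast
    then obtain h k where hk: "h \<in> Hom C (Cod C f) (representative c)"
      "k \<in> Hom C (representative c) (Cod C f)"
      "k \<cdot> h = Ident C (Cod C f)" "h \<cdot> k = Ident C (representative c)"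
      unfolding iso_rel_def by blast
    \<comment> \<open>The codomain of \<open>f\<close> need not be the chosen representative; moving
      \<open>f\<close> along the isomorphism \<open>h\<close> corrects this within the same morphism
      class.\<close>
    let ?g = "h \<cdot> f"
    have g: "?g \<in> Hom C (x i) (representative c)" by (rule comp_hom[OF f(1) hk(1)])
    have kg: "f = k \<cdot> ?g" using comp_assoc[OF f(1) hk(1,2)] hk(3) ident_comp[OF f(1)] by simp
    have fm: "f \<in> Mor C" "Dom C f = x i" and gm: "?g \<in> Mor C" "Dom C ?g = x i"
      and cg: "Cod C ?g = representative c"
      using f(1) g by (simp_all add: Hom_def)
    have "?g \<in> mor_class C (x i) f"
      unfolding mem_mor_class cg
      by (intro conjI fm gm bexI[of _ h] bexI[of _ k] refl) (fact kg hk)+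
    then have Fg: "F = mor_class C (x i) ?g" using f(2) mor_class_eqI by simp
    have st: "(i, ?g) \<in> standard_terms (representative c)"
      using g i Fc(2) mor_class_in_leading_ideal[OF i g] Fg
      by (simp add: standard_terms_def terms_def)
    \<comment> \<open>The fibre contains only classes of nonzero dimension, and the standard term
      just found supplies this condition.\<close>
    then have "class_dim K M c \<noteq> 0"
      using class_dim_eq[OF c] finite_standard_terms by auto
    moreover have "\<nu> c = n" using words(4)[OF i f(1)] f(2) len c_def by simp
    ultimately have "c \<in> norm_fibre C \<nu> K M n" using c by (simp add: norm_fibre_def)
    then have "(c, i, ?g) \<in> ?A" using st by simp
    then show "q \<in> (\<lambda>(c, i, f). (i, mor_class C (x i) f)) ` ?A"
      unfolding q by (rule rev_image_eqI) (simp add: Fg)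
  qed
qed

lemma finite_standard_classes: "i < m \<Longrightarrow> finite (standard_classes n i)"
  by (rule finite_subset[OF _ finite_classes_of_length[of i n]]) (auto simp: standard_classes_def)

text \<open>Finiteness is transported along \<open>bij_standard\<close> from the word side. Every
  class in the fibre has a standard term, so projecting the finite set of pairs reaches the whole
  fibre.\<close>

lemma finite_norm_fibre: "finite (norm_fibre C \<nu> K M n)"
proof -
  have "finite (SIGMA i:{..<m}. standard_classes n i)"
    using finite_standard_classes by (intro finite_SigmaI) auto
  then have "finite (SIGMA c:norm_fibre C \<nu> K M n. standard_terms (representative c))"
    using bij_betw_finite[OF bij_standard] by blast
  then have "finite (fst ` (SIGMA c:norm_fibre C \<nu> K M n. standard_terms (representative c)))"
    by (rule finite_imageI)
  moreover have "standard_terms (representative c) \<noteq> {}" if "c \<in> norm_fibre C \<nu> K M n" for c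
    using that class_dim_eq by (force simp: norm_fibre_def)
  then have "norm_fibre C \<nu> K M n
      \<subseteq> fst ` (SIGMA c:norm_fibre C \<nu> K M n. standard_terms (representative c))"
    by (force simp: image_iff)
  ultimately show ?thesis by (rule rev_finite_subset)
qed

lemma hilbert_coefficient:
  "(\<Sum>c\<in>norm_fibre C \<nu> K M n. class_dim K M c) = (\<Sum>i<m. card (standard_classes n i))"
proof -
  have "(\<Sum>c\<in>norm_fibre C \<nu> K M n. class_dim K M c)
      = (\<Sum>c\<in>norm_fibre C \<nu> K M n. card (standard_terms (representative c)))"
    by (rule sum.cong) (auto simp: norm_fibre_def class_dim_eq)
  also have "\<dots> = card (SIGMA c:norm_fibre C \<nu> K M n. standard_terms (representative c))"
    using finite_norm_fibre finite_standard_terms by simp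
  also have "\<dots> = card (SIGMA i:{..<m}. standard_classes n i)"
    by (rule bij_betw_same_card[OF bij_standard])
  also have "\<dots> = (\<Sum>i<m. card (standard_classes n i))"
    using finite_standard_classes by simp
  finally show ?thesis .
qed

text \<open>Since \<open>\<iota> i\<close> is injective, counting words of length \<open>n\<close>
  in a language is counting the classes they encode.\<close>

lemma card_standard_classes:
  assumes i: "i < m"
  shows "int (card (standard_classes n i)) =
    fps_nth (lang_series (\<iota> i ` mor_classes C (x i)) - lang_series (\<iota> i ` leading_ideal i)) n"
proof -
  let ?S = "\<lambda>X. {F \<in> X. length (\<iota> i F) = n}"
  have "fps_nth (lang_series (\<iota> i ` X)) n = int (card (?S X))" if "X \<subseteq> mor_classes C (x i)" for X
  proof -
    have "{w \<in> \<iota> i ` X. length w = n} = \<iota> i ` ?S X" by auto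
    moreover have "inj_on (\<iota> i) (?S X)"
      using words(3)[OF i] by (rule inj_on_subset) (use that in auto)
    ultimately show ?thesis by (simp add: lang_series_def card_image)
  qed
  moreover have "leading_ideal i \<subseteq> mor_classes C (x i)" by (auto simp: leading_ideal_def)
  \<comment> \<open>A difference of nested finite sets: nesting makes the cardinalities subtract,
    and makes natural and integer subtraction agree.\<close>
  moreover have "standard_classes n i = ?S (mor_classes C (x i)) - ?S (leading_ideal i)"
    by (auto simp: standard_classes_def)
  moreover have "?S (leading_ideal i) \<subseteq> ?S (mor_classes C (x i))" by (auto simp: leading_ideal_def)
  ultimately show ?thesis
    using finite_classes_of_length[OF i, of n]
    by (simp add: card_Diff_subset finite_subset of_nat_diff card_mono)
qed

lemma hilbert_series_eq:
  "hilbert_series C \<nu> K M =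
    (\<Sum>i<m. lang_series (\<iota> i ` mor_classes C (x i)) - lang_series (\<iota> i ` leading_ideal i))"
proof (rule fps_ext)
  fix n
  have "fps_nth (hilbert_series C \<nu> K M) n = int (\<Sum>c\<in>norm_fibre C \<nu> K M n. class_dim K M c)"
    by (simp add: hilbert_series_def)
  also have "\<dots> = (\<Sum>i<m. int (card (standard_classes n i)))"
    by (simp add: hilbert_coefficient)
  finally show "fps_nth (hilbert_series C \<nu> K M) n = fps_nth
    (\<Sum>i<m. lang_series (\<iota> i ` mor_classes C (x i)) - lang_series (\<iota> i ` leading_ideal i)) n"
    by (simp add: card_standard_classes fps_sum_nth)
qed

lemma hilbert_defined: "hilbert_defined C \<nu> K M"
  unfolding hilbert_defined_def using dim_space(1) finite_norm_fibre by blast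

end

section \<open>Assembling the integer combination\<close>

text \<open>Allows the two languages of each generator to be listed in one family, at the indices
  \<open>2 * i\<close> and \<open>2 * i + 1\<close>.\<close>

lemma sum_interleave:
  fixes g :: "nat \<Rightarrow> 'b :: comm_monoid_add"
  shows "(\<Sum>k<2 * n. g k) = (\<Sum>i<n. g (2 * i) + g (2 * i + 1))"
  by (induction n) (simp_all add: add.assoc)

theorem theorem1p2p1:
  fixes P :: "'a lang set"
    and C :: "('o, 'm) cat"
    and \<nu> :: "'o set \<Rightarrow> nat"
    and K :: "'k ring"
    and M :: "('o, 'm, 'k, 'v) rep"
  assumes "language_class P"
    and "groebner_category C"
    and "lingual_category P C \<nu>"
    and "field K"
    and "cat_representation C K M"
    and "finitely_generated C K M"
  shows "hilbert_defined C \<nu> K M \<and>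
    (\<exists>(n :: nat) (a :: nat \<Rightarrow> int) (\<Sigma> :: nat \<Rightarrow> 'a set) (L :: nat \<Rightarrow> 'a list set).
       (\<forall>i<n. (\<Sigma> i, L i) \<in> P) \<and>
       hilbert_series C \<nu> K M = (\<Sum>i<n. fps_const (a i) * lang_series (L i)))"
proof -
  obtain S where S: "finite S" "S \<subseteq> Sigma (Obj C) (\<lambda>x. carrier (Space M x))"
    and gen: "\<forall>N. subrepresentation C K M N \<and> (\<forall>(x, v)\<in>S. v \<in> N x) \<longrightarrow>
      (\<forall>y\<in>Obj C. N y = carrier (Space M y))"
    using assms(6) unfolding finitely_generated_def by (elim exE conjE) (rule that)
  obtain m :: nat and s where s: "S = s ` {i. i < m}"
    using finite_imp_nat_seg_image_inj_on[OF S(1)] by blast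
  define x where "x = fst \<circ> s"
  define v where "v = snd \<circ> s"
  have obj: "x i \<in> Obj C" "v i \<in> carrier (Space M (x i))" if "i < m" for i
  proof -
    have "s i \<in> Sigma (Obj C) (\<lambda>x. carrier (Space M x))" using S(2) s that by auto
    then show "x i \<in> Obj C" "v i \<in> carrier (Space M (x i))"
      by (auto simp: x_def v_def)
  qed
  \<comment> \<open>The bound on \<open>i\<close> sits inside the existential so that one choice
    function defined on all indices can be extracted.\<close>
  have "\<forall>i. \<exists>r. i < m \<longrightarrow> admissible_order C (x i) r"
    using assms(2) obj(1) unfolding groebner_category_def by blast
  then obtain R where R: "\<And>i. i < m \<Longrightarrow> admissible_order C (x i) (R i)" by metis
  have "\<forall>i. \<exists>A j. i < m \<longrightarrow> lingual_structure P C \<nu> (x i) A j"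
    using assms(3) obj(1) unfolding lingual_category_def by blast
  then obtain \<Sigma> \<iota> where ling: "\<And>i. i < m \<Longrightarrow> lingual_structure P C \<nu> (x i) (\<Sigma> i) (\<iota> i)" by metis
  have dir: "category C" "\<And>y f. y \<in> Obj C \<Longrightarrow> f \<in> Hom C y y \<Longrightarrow> f = Ident C y"
    using assms(2) unfolding groebner_category_def directed_category_def by blast+
  interpret category C by (rule dir(1))
  interpret generated_representation C K M \<nu> P m x v R \<Sigma> \<iota>
  proof unfold_locales
    fix N y assume N: "subrepresentation C K M N" "\<And>i. i < m \<Longrightarrow> v i \<in> N (x i)" "y \<in> Obj C"
    have "\<forall>(x, v)\<in>S. v \<in> N x" using N(2) unfolding s x_def v_def by (auto simp: split_beta)
    then show "N y = carrier (Space M y)" using gen N by blast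
  qed (use dir assms(5) obj R ling in auto)
  \<comment> \<open>Even indices carry all classes, with coefficient 1; odd indices carry the
    leading ideal, with coefficient -1.\<close>
  define L where "L k = \<iota> (k div 2) ` (if even k then mor_classes C (x (k div 2))
     else leading_ideal (k div 2))" for k
  have "(\<Sigma> (k div 2), L k) \<in> P" if "k < 2 * m" for k
  proof -
    have "k div 2 < m" using that by auto
    then show ?thesis using lang_in_class by (simp add: L_def)
  qed
  moreover have "hilbert_series C \<nu> K M =
      (\<Sum>k<2 * m. fps_const ((- 1) ^ k) * lang_series (L k))"
    unfolding sum_interleave hilbert_series_eq
    by (rule sum.cong) (simp_all add: L_def flip: fps_const_neg)
  ultimately show ?thesis using hilbert_defined
    by (intro conjI exI[of _ "2 * m"] exI[of _ "\<lambda>k. (- 1) ^ k"] exI[of _ "\<lambda>k. \<Sigma> (k div 2)"]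
        exI[of _ L]) auto
qed

end
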